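(* Let $C$ be a categorical class variable with sample space $\mathbb{C}$ and let $\bm{X}=(X_1,\dots,X_p)$ be a vector of categorical features with sample spaces $\mathbb{X}_1,\dots,\mathbb{X}_p$. Let $\mathcal{M}_{\mathcal{G}}^{\mathrm{naive}}$ be the space of naive Bayesian network classifiers and $\mathcal{M}_T^{\mathrm{naive}}$ the space of naive staged tree classifiers for the class $C$ and the features $\bm{X}$. Then $$\mathcal{M}_{\mathcal{G}}^{\mathrm{naive}}\subset\mathcal{M}_T^{\mathrm{naive}}.$$
   Context: Write $\mathbb{X}_{[i]}=\mathbb{X}_1\times\cdots\times\mathbb{X}_i$ and $\mathbb{X}=\mathbb{X}_{[p]}$; sample spaces are finite. Bayesian network models. For a directed acyclic graph $G$ whose vertices are the variables $C,X_1,\dots,X_p$, a probability mass function $P$ on $\mathbb{C}\times\mathbb{X}$ is Markov to $G$ if it factorizes as the product, over the variables, of the conditional probability of each variable given its parents in $G$. The Bayesian network model of $G$ is the set of all $P$ in the probability simplex $\Delta_{|\mathbb{C}\times\mathbb{X}|-1}$ that are Markov to $G$. The naive Bayesian network classifier (naive Bayes) is the one whose graph has exactly the edges $C\to X_k$, $k=1,\dots,p$. Thus $\mathcal{M}_{\mathcal{G}}^{\mathrm{naive}}$ is the set of $P$ in the simplex with $P(c,x_1,\dots,x_p)=P(c)\prod_{k=1}^pP(x_k\mid c)$. Staged trees. A $(C,\bm{X})$-compatible staged tree (also called a staged tree classifier) is a triple $T=(V,E,\theta)$ where $(V,E)$ is the rooted directed tree whose vertices are a root $v_0$ and all tuples $(c,x_1,\dots,x_i)\in\mathbb{C}\times\mathbb{X}_{[i]}$,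 $0\le i\le p$, and whose edges are $(v_0,c)$ for $c\in\mathbb{C}$ and $((c,x_1,\dots,x_{i-1}),(c,x_1,\dots,x_i))$ for $1\le i\le p$. The edge labelling $\theta$ is defined through a function $\kappa:V\to\mathcal{L}$ (the colouring; $\mathcal{L}$ is a set of labels) by $\theta(v_0,c)=(\kappa(v_0),c)$ and $\theta(v,(c,x_1,\dots,x_i))=(\kappa(v),x_i)$ for $v=(c,x_1,\dots,x_{i-1})$. Let $E(v)$ be the set of edges emanating from $v$. Two internal vertices $v,w$ are in the same stage if $\theta(E(v))=\theta(E(w))$; only vertices at the same distance from the root can be in the same stage. The stages partition the internal vertices. Staged tree models. The parameter space of $T$ is $$\Theta_T=\Big\{y\in\mathbb{R}^{|\theta(E)|} : y_{\theta(e)}\in(0,1)\text{ for all } e\in E,\ \sum_{e\in E(v)}y_{\theta(e)}=1 \text{ for every internal vertex } v\Big\}.$$ The staged tree model of $T$ is the set of mass functions on the leaves of $T$ (identified with $\mathbb{C}\times\mathbb{X}$) of the form $P(l)=\prod_{e\in\lambda(l)}y_{\theta(e)}$ with $y\in\Theta_T$, where $\lambda(l)$ is the path from the root to the leaf $l$. Naive staged tree classifiers. Let $V_k$ be the set of vertices at distance $k$ from the root. A $(C,\bm{X})$-compatible staged tree classifier is called naive if, for every $1\le k\le p$, the set $V_k$ is partitioned into $|\mathbb{C}|$ stages. $\mathcal{M}_T^{\mathrm{naive}}$ is the space (union of the staged tree models) of all naive staged tree classifiers for $C$ and $\bm{X}$, with variable order $C,X_1,\dots,X_p$.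
   Formalization: The simplex is taken open (only strictly positive P), every sample space has at least two elements, and strict inclusion is claimed only for p ≥ 2 (plain inclusion for all p); otherwise the claim fails because tree parameters lie in (0,1), and for p ≤ 1 the two spaces coincide. *)

theory Defs
  imports "HOL-Probability.Probability"
begin

(* C is the sample space of the class, X k (1 \<le> k \<le> p) that of the k-th feature. The feature
   vector is a list, so the value of the k-th feature sits at position k - 1. *)

definition prefixes :: "(nat \<Rightarrow> 'x set) \<Rightarrow> nat \<Rightarrow> 'x list set" where
  "prefixes X i = {xs. length xs = i \<and> (\<forall>j<i. xs ! j \<in> X (Suc j))}"

definition outcomes :: "'c set \<Rightarrow> (nat \<Rightarrow> 'x set) \<Rightarrow> nat \<Rightarrow> ('c \<times> 'x list) set" where
  "outcomes C X p = C \<times> prefixes X p"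

(* The open simplex: staged tree parameters lie in the open interval (0,1), so staged tree models
   contain only strictly positive mass functions; moreover P(x | c) needs P(c) > 0. *)
definition prob_simplex :: "'a set \<Rightarrow> 'a pmf set" where
  "prob_simplex \<Omega> = {P. set_pmf P = \<Omega>}"

datatype rv = Class | Feature nat

definition rvs :: "nat \<Rightarrow> rv set" where
  "rvs p = insert Class (Feature ` {1..p})"

fun rv_val :: "rv \<Rightarrow> 'c \<times> 'x list \<Rightarrow> 'c + 'x" where
  "rv_val Class (c, xs) = Inl c"
| "rv_val (Feature k) (c, xs) = Inr (xs ! (k - 1))"

definition dag :: "nat \<Rightarrow> (rv \<times> rv) set \<Rightarrow> bool" where
  "dag p G \<longleftrightarrow> G \<subseteq> rvs p \<times> rvs p \<and> acyclic G"

definition parents :: "(rv \<times> rv) set \<Rightarrow> rv \<Rightarrow> rv set" where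
  "parents G v = {u. (u, v) \<in> G}"

definition markov ::
    "'c set \<Rightarrow> (nat \<Rightarrow> 'x set) \<Rightarrow> nat \<Rightarrow> (rv \<times> rv) set \<Rightarrow> ('c \<times> 'x list) pmf \<Rightarrow> bool" where
  "markov C X p G P \<longleftrightarrow> (\<forall>w \<in> outcomes C X p.
     pmf P w = (\<Prod>v \<in> rvs p.
       \<P>(w' in measure_pmf P. rv_val v w' = rv_val v w
            \<bar> \<forall>u \<in> parents G v. rv_val u w' = rv_val u w)))"

definition bn_model ::
    "'c set \<Rightarrow> (nat \<Rightarrow> 'x set) \<Rightarrow> nat \<Rightarrow> (rv \<times> rv) set \<Rightarrow> ('c \<times> 'x list) pmf set" where
  "bn_model C X p G = {P \<in> prob_simplex (outcomes C X p). markov C X p G P}"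

definition naive_graph :: "nat \<Rightarrow> (rv \<times> rv) set" where
  "naive_graph p = {(Class, Feature k) | k. k \<in> {1..p}}"

lemma dag_naive_graph: "dag p (naive_graph p)"
proof -
  have "acyclic (naive_graph p)"
    by (rule acyclicI_order[where f = "\<lambda>v. case v of Class \<Rightarrow> 1 | Feature k \<Rightarrow> (0::nat)"])
       (auto simp: naive_graph_def)
  then show ?thesis
    by (auto simp: dag_def rvs_def naive_graph_def)
qed

definition naive_bn_space :: "'c set \<Rightarrow> (nat \<Rightarrow> 'x set) \<Rightarrow> nat \<Rightarrow> ('c \<times> 'x list) pmf set" where
  "naive_bn_space C X p = bn_model C X p (naive_graph p)"

(* Node c [x_1, ..., x_i] is the vertex (c, x_1, ..., x_i). *)
datatype ('c, 'x) vertex = Root | Node 'c "'x list"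

type_synonym ('c, 'x) edge = "('c, 'x) vertex \<times> ('c, 'x) vertex"

fun depth :: "('c, 'x) vertex \<Rightarrow> nat" where
  "depth Root = 0"
| "depth (Node c xs) = Suc (length xs)"

definition vertices :: "'c set \<Rightarrow> (nat \<Rightarrow> 'x set) \<Rightarrow> nat \<Rightarrow> ('c, 'x) vertex set" where
  "vertices C X p = insert Root {Node c xs | c xs i. c \<in> C \<and> i \<le> p \<and> xs \<in> prefixes X i}"

definition edges :: "'c set \<Rightarrow> (nat \<Rightarrow> 'x set) \<Rightarrow> nat \<Rightarrow> ('c, 'x) edge set" where
  "edges C X p = {(Root, Node c []) | c. c \<in> C} \<union>
     {(Node c xs, Node c (xs @ [x])) | c xs x i.
        c \<in> C \<and> i < p \<and> xs \<in> prefixes X i \<and> x \<in> X (Suc i)}"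

definition out_edges :: "'c set \<Rightarrow> (nat \<Rightarrow> 'x set) \<Rightarrow> nat \<Rightarrow> ('c, 'x) vertex \<Rightarrow> ('c, 'x) edge set" where
  "out_edges C X p v = {e \<in> edges C X p. fst e = v}"

definition internal :: "'c set \<Rightarrow> (nat \<Rightarrow> 'x set) \<Rightarrow> nat \<Rightarrow> ('c, 'x) vertex set" where
  "internal C X p = {v \<in> vertices C X p. out_edges C X p v \<noteq> {}}"

(* Since the tree is finite, natural numbers provide enough colours. *)
type_synonym ('c, 'x) colouring = "('c, 'x) vertex \<Rightarrow> nat"
type_synonym ('c, 'x) label = "nat \<times> ('c + 'x)"

fun last_value :: "('c, 'x) vertex \<Rightarrow> 'c + 'x" where
  "last_value (Node c xs) = (if xs = [] then Inl c else Inr (last xs))"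
| "last_value Root = undefined"

fun edge_label :: "('c, 'x) colouring \<Rightarrow> ('c, 'x) edge \<Rightarrow> ('c, 'x) label" where
  "edge_label \<kappa> (v, w) = (\<kappa> v, last_value w)"

definition stage_rel ::
    "'c set \<Rightarrow> (nat \<Rightarrow> 'x set) \<Rightarrow> nat \<Rightarrow> ('c, 'x) colouring \<Rightarrow> ('c, 'x) edge set" where
  "stage_rel C X p \<kappa> = {(v, w). v \<in> internal C X p \<and> w \<in> internal C X p \<and>
     edge_label \<kappa> ` out_edges C X p v = edge_label \<kappa> ` out_edges C X p w}"

(* Vertices and edges of a compatible tree are determined by C, X and p, so a staged tree is given
   by its colouring. *)
definition staged_tree ::
    "'c set \<Rightarrow> (nat \<Rightarrow> 'x set) \<Rightarrow> nat \<Rightarrow> ('c, 'x) colouring \<Rightarrow> bool" where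
  "staged_tree C X p \<kappa> \<longleftrightarrow> (\<forall>(v, w) \<in> stage_rel C X p \<kappa>. depth v = depth w)"

(* Only the values of y on the labels that occur matter. *)
definition tree_params ::
    "'c set \<Rightarrow> (nat \<Rightarrow> 'x set) \<Rightarrow> nat \<Rightarrow> ('c, 'x) colouring \<Rightarrow> (('c, 'x) label \<Rightarrow> real) set" where
  "tree_params C X p \<kappa> = {y.
     (\<forall>e \<in> edges C X p. y (edge_label \<kappa> e) \<in> {0<..<1}) \<and>
     (\<forall>v \<in> internal C X p. (\<Sum>e \<in> out_edges C X p v. y (edge_label \<kappa> e)) = 1)}"

fun root_path :: "('c, 'x) vertex \<Rightarrow> ('c, 'x) edge set" where
  "root_path Root = {}"
| "root_path (Node c xs) = insert (Root, Node c [])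
     {(Node c (take i xs), Node c (take (Suc i) xs)) | i. i < length xs}"

definition staged_tree_model ::
    "'c set \<Rightarrow> (nat \<Rightarrow> 'x set) \<Rightarrow> nat \<Rightarrow> ('c, 'x) colouring \<Rightarrow> ('c \<times> 'x list) pmf set" where
  "staged_tree_model C X p \<kappa> = {P. set_pmf P \<subseteq> outcomes C X p \<and>
     (\<exists>y \<in> tree_params C X p \<kappa>. \<forall>(c, xs) \<in> outcomes C X p.
        pmf P (c, xs) = (\<Prod>e \<in> root_path (Node c xs). y (edge_label \<kappa> e)))}"

definition level :: "'c set \<Rightarrow> (nat \<Rightarrow> 'x set) \<Rightarrow> nat \<Rightarrow> nat \<Rightarrow> ('c, 'x) vertex set" where
  "level C X p k = {v \<in> vertices C X p. depth v = k}"

definition naive_staged_tree ::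
    "'c set \<Rightarrow> (nat \<Rightarrow> 'x set) \<Rightarrow> nat \<Rightarrow> ('c, 'x) colouring \<Rightarrow> bool" where
  "naive_staged_tree C X p \<kappa> \<longleftrightarrow> staged_tree C X p \<kappa> \<and>
     (\<forall>k \<in> {1..p}. card (level C X p k // stage_rel C X p \<kappa>) = card C)"

definition naive_staged_space :: "'c set \<Rightarrow> (nat \<Rightarrow> 'x set) \<Rightarrow> nat \<Rightarrow> ('c \<times> 'x list) pmf set" where
  "naive_staged_space C X p = (\<Union>\<kappa> \<in> {\<kappa>. naive_staged_tree C X p \<kappa>}. staged_tree_model C X p \<kappa>)"

end

theory Submission
  imports Defs
begin

text \<open>
  A naive Bayes mass function is a product \<open>q c * (\<Prod>i<p. r i c (xs ! i))\<close>. Colour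
  the vertex \<open>(c, xs)\<close> by its depth and by \<open>h c xs\<close>, where \<open>h _ xs\<close> is
  a permutation of \<open>C\<close> for every \<open>xs\<close>; this always gives a naive staged tree,
  whose model contains the mass functions \<open>q c * (\<Prod>i<p. r i (h c (take i xs)) (xs ! i))\<close>. The choice
  \<open>h c xs = c\<close> gives the inclusion. If instead \<open>h\<close> swaps two classes after
  the single feature value \<open>a\<close>, then the law of the second feature given the class depends on
  the first feature, which is impossible in a naive Bayes model.
\<close>

section \<open>Feature tuples\<close>

lemma prefixes_0 [simp]: "prefixes X 0 = {[]}"
  by (auto simp: prefixes_def)

text \<open>Splitting off the last value gives a recursion on the length, the basis for finiteness,
  nonemptiness and sums over feature tuples.\<close>

lemma prefixes_Suc:
  "prefixes X (Suc n) = (\<lambda>(xs, x). xs @ [x]) ` (prefixes X n \<times> X (Suc n))"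
proof (intro equalityI subsetI)
  fix zs assume zs: "zs \<in> prefixes X (Suc n)"
  then have "zs = butlast zs @ [last zs]" and "length zs = Suc n"
    by (auto simp: prefixes_def intro!: append_butlast_last_id[symmetric])
  moreover have "butlast zs \<in> prefixes X n"
    using zs by (auto simp: prefixes_def nth_butlast)
  moreover have "last zs \<in> X (Suc n)"
    using zs by (subst last_conv_nth) (auto simp: prefixes_def)
  ultimately show "zs \<in> (\<lambda>(xs, x). xs @ [x]) ` (prefixes X n \<times> X (Suc n))"
    by (metis (mono_tags, lifting) SigmaI case_prod_conv image_eqI)
next
  fix zs assume "zs \<in> (\<lambda>(xs, x). xs @ [x]) ` (prefixes X n \<times> X (Suc n))"
  then show "zs \<in> prefixes X (Suc n)"
    by (auto simp: prefixes_def nth_append less_Suc_eq)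
qed

lemma take_prefixes:
  "xs \<in> prefixes X n \<Longrightarrow> i \<le> n \<Longrightarrow> take i xs \<in> prefixes X i"
  by (auto simp: prefixes_def)

lemma nth_prefixes: "xs \<in> prefixes X n \<Longrightarrow> i < n \<Longrightarrow> xs ! i \<in> X (Suc i)"
  by (auto simp: prefixes_def)

lemma length_prefixes: "xs \<in> prefixes X n \<Longrightarrow> length xs = n"
  by (auto simp: prefixes_def)

lemma update_prefixes:
  assumes "xs \<in> prefixes X n" "x \<in> X (Suc i)"
  shows "xs[i := x] \<in> prefixes X n"
proof -
  have "xs[i := x] ! j \<in> X (Suc j)" if "j < n" for j
    using assms that by (cases "j = i") (auto simp: prefixes_def)
  then show ?thesis
    using assms by (simp add: prefixes_def)
qed

lemma sum_prefixes_Suc: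
  "(\<Sum>zs\<in>prefixes X (Suc n). f zs) = (\<Sum>xs\<in>prefixes X n. \<Sum>x\<in>X (Suc n). f (xs @ [x]))"
proof -
  have "inj_on (\<lambda>(xs, x). xs @ [x]) (prefixes X n \<times> X (Suc n))"
    by (auto simp: inj_on_def)
  then show ?thesis
    by (simp add: prefixes_Suc sum.reindex sum.cartesian_product case_prod_unfold)
qed

section \<open>Edges and root-to-leaf paths\<close>

lemma root_path_prod:
  fixes g :: "('c, 'x) edge \<Rightarrow> 'b :: comm_monoid_mult"
  shows "(\<Prod>e\<in>root_path (Node c xs). g e) =
    g (Root, Node c []) * (\<Prod>i<length xs. g (Node c (take i xs), Node c (take (Suc i) xs)))"
proof -
  let ?s = "\<lambda>i. (Node c (take i xs), Node c (take (Suc i) xs))"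
  \<comment> \<open>A path is a set of edges, so one factor per step requires the steps to be
    distinct; the length of the source vertex tells them apart.\<close>
  have inj: "inj_on ?s {..<length xs}"
  proof (rule inj_onI)
    fix i j assume "i \<in> {..<length xs}" "j \<in> {..<length xs}" "?s i = ?s j"
    then have "length (take i xs) = length (take j xs)" "i < length xs" "j < length xs"
      by auto
    then show "i = j" by simp
  qed
  have path: "root_path (Node c xs) = insert (Root, Node c []) (?s ` {..<length xs})"
    by auto
  have "(Root, Node c []) \<notin> ?s ` {..<length xs}" by auto
  then show ?thesis
    unfolding path by (simp add: prod.reindex[OF inj] del: take_Suc_conv_app_nth)
qed

lemma rv_val_eq:
  "rv_val Class w = Inl (fst w)" "rv_val (Feature k) w = Inr (snd w ! (k - 1))"
  by (cases w; simp)+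

lemma out_edges_Root: "out_edges C X p Root = (\<lambda>c. (Root, Node c [])) ` C"
  by (auto simp: out_edges_def edges_def)

lemma out_edges_Node:
  assumes "c \<in> C" "xs \<in> prefixes X i" "i < p"
  shows "out_edges C X p (Node c xs) = (\<lambda>x. (Node c xs, Node c (xs @ [x]))) ` X (Suc i)"
  using assms by (auto simp: out_edges_def edges_def prefixes_def)

lemma edges_cases:
  assumes "e \<in> edges C X p"
  obtains c where "c \<in> C" "e = (Root, Node c [])"
  | c xs x i where "c \<in> C" "i < p" "xs \<in> prefixes X i" "x \<in> X (Suc i)"
      "e = (Node c xs, Node c (xs @ [x]))"
  using assms by (auto simp: edges_def)

lemma internal_cases:
  assumes "v \<in> internal C X p"
  obtains "v = Root"
  | c xs i where "c \<in> C" "i < p" "xs \<in> prefixes X i" "v = Node c xs"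
proof -
  from assms obtain e where "e \<in> edges C X p" "fst e = v"
    by (auto simp: internal_def out_edges_def)
  then show ?thesis
    by (cases rule: edges_cases) (auto intro: that)
qed

section \<open>Finite sums, quotients and mass functions\<close>

text \<open>With at least two positive terms, removing one leaves a positive sum. This gives the
  upper bound of the open interval required of tree parameters.\<close>

lemma less_one_of_sum_eq_one:
  fixes f :: "'a \<Rightarrow> real"
  assumes "finite A" "card A \<ge> 2" "\<And>x. x \<in> A \<Longrightarrow> f x > 0" "sum f A = 1" "x \<in> A"
  shows "f x < 1"
proof -
  have "A - {x} \<noteq> {}"
    using assms(1,2,5) by (metis One_nat_def card_Diff_singleton card.empty
        diff_is_0_eq not_less_eq_eq numeral_2_eq_2)
  then have "0 < sum f (A - {x})"
    using assms by (intro sum_pos) auto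
  then show ?thesis
    using assms(1,4,5) by (simp add: sum_diff1)
qed

text \<open>The classes are the nonempty fibres of \<open>g\<close> on \<open>A\<close>, one for
  each value. With a colouring as \<open>g\<close>, stages are counted by colours.\<close>

lemma card_quotient_eq_card_image:
  assumes "\<And>v. v \<in> A \<Longrightarrow> r `` {v} = {w \<in> A. g w = g v}"
  shows "card (A // r) = card (g ` A)"
proof -
  have "A // r = (\<lambda>y. {w \<in> A. g w = y}) ` g ` A"
    using assms by (auto simp: quotient_def)
  moreover have "inj_on (\<lambda>y. {w \<in> A. g w = y}) (g ` A)"
    by (auto simp: inj_on_def)
  ultimately show ?thesis
    by (simp add: card_image)
qed

lemma obtain_pmf:
  fixes f :: "'a \<Rightarrow> real"
  assumes "finite A" "\<And>x. x \<in> A \<Longrightarrow> f x \<ge> 0" "sum f A = 1"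
  obtains P where "set_pmf P \<subseteq> A" "\<And>x. x \<in> A \<Longrightarrow> pmf P x = f x"
proof
  define g where "g x = (if x \<in> A then f x else 0)" for x
  have "(\<integral>\<^sup>+ x. ennreal (g x) \<partial>count_space UNIV) = (\<Sum>x\<in>A. ennreal (g x))"
    using assms(1) by (intro nn_integral_count_space'[where A = A]) (auto simp: g_def)
  also have "\<dots> = 1"
    using assms by (simp add: g_def)
  finally have pmf: "pmf (embed_pmf g) x = g x" for x
    using assms(2) by (intro pmf_embed_pmf) (auto simp: g_def)
  then show "set_pmf (embed_pmf g) \<subseteq> A"
    by (auto simp: set_pmf_eq g_def split: if_splits)
  show "\<And>x. x \<in> A \<Longrightarrow> pmf (embed_pmf g) x = f x"
    by (simp add: pmf g_def)
qed

text \<open>A sample space with one element would force the parameter of its edge to be 1, outside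
  the open interval, and staged tree models would be empty.\<close>

locale classifier =
  fixes C :: "'c set" and X :: "nat \<Rightarrow> 'x set" and p :: nat
  assumes finite_C: "finite C" and card_C: "card C \<ge> 2"
    and finite_X: "\<And>k. k \<in> {1..p} \<Longrightarrow> finite (X k)"
    and card_X: "\<And>k. k \<in> {1..p} \<Longrightarrow> card (X k) \<ge> 2"
begin

lemma finite_X_Suc: "i < p \<Longrightarrow> finite (X (Suc i))"
  using finite_X by simp

lemma card_X_Suc: "i < p \<Longrightarrow> card (X (Suc i)) \<ge> 2"
  using card_X by simp

lemma X_nonempty: "i < p \<Longrightarrow> X (Suc i) \<noteq> {}"
  using card_X_Suc by fastforce

lemma finite_prefixes: "i \<le> p \<Longrightarrow> finite (prefixes X i)"
  by (induction i) (auto simp: prefixes_Suc finite_X_Suc)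

lemma prefixes_nonempty: "i \<le> p \<Longrightarrow> prefixes X i \<noteq> {}"
  by (induction i) (auto simp: prefixes_Suc Suc_le_eq dest: X_nonempty)

lemma Node_internal:
  "c \<in> C \<Longrightarrow> xs \<in> prefixes X i \<Longrightarrow> i < p \<Longrightarrow> Node c xs \<in> internal C X p"
  using X_nonempty by (auto simp: internal_def vertices_def out_edges_Node intro: less_imp_le)

lemma level_Suc: "i \<le> p \<Longrightarrow> level C X p (Suc i) = {Node c xs | c xs. c \<in> C \<and> xs \<in> prefixes X i}"
  by (auto simp: level_def vertices_def prefixes_def)

text \<open>The last coordinate sums to 1 for every history, then the one before it, and so on. The
  laws may depend on the history, as the strictness example requires.\<close>

lemma sum_prefixes_prod:
  fixes r :: "nat \<Rightarrow> 'x list \<Rightarrow> 'x \<Rightarrow> real"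
  assumes "\<And>i xs. i < n \<Longrightarrow> xs \<in> prefixes X i \<Longrightarrow> (\<Sum>x\<in>X (Suc i). r i xs x) = 1"
  shows "(\<Sum>xs\<in>prefixes X n. \<Prod>i<n. r i (take i xs) (xs ! i)) = 1"
  using assms
proof (induction n)
  case (Suc n)
  have "(\<Prod>i<Suc n. r i (take i (xs @ [x])) ((xs @ [x]) ! i)) =
      (\<Prod>i<n. r i (take i xs) (xs ! i)) * r n xs x" if "xs \<in> prefixes X n" for xs x
    using that by (simp add: length_prefixes nth_append)
  then have "(\<Sum>xs\<in>prefixes X (Suc n). \<Prod>i<Suc n. r i (take i xs) (xs ! i)) =
      (\<Sum>xs\<in>prefixes X n. \<Sum>x\<in>X (Suc n). (\<Prod>i<n. r i (take i xs) (xs ! i)) * r n xs x)"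
    unfolding sum_prefixes_Suc by (intro sum.cong refl) blast
  also have "\<dots> = (\<Sum>xs\<in>prefixes X n. \<Prod>i<n. r i (take i xs) (xs ! i))"
    using Suc.prems[of n] by (simp add: sum_distrib_left[symmetric])
  also have "\<dots> = 1"
    using Suc by simp
  finally show ?case .
qed simp

section \<open>Colourings by depth and relabelled class\<close>

text \<open>Colours are natural numbers, so \<open>prod_encode\<close> packs a pair. Its first
  component is the depth, which keeps levels apart; \<open>f\<close> numbers the classes, and
  \<open>h c xs\<close> is the class whose feature law applies at the vertex
  \<open>Node c xs\<close>.\<close>

fun class_colouring :: "('c \<Rightarrow> nat) \<Rightarrow> ('c \<Rightarrow> 'x list \<Rightarrow> 'c) \<Rightarrow> ('c, 'x) colouring" where
  "class_colouring f h Root = prod_encode (0, 0)"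
| "class_colouring f h (Node c xs) = prod_encode (Suc (length xs), f (h c xs))"

lemma class_colouring_depth:
  "class_colouring f h v = class_colouring f h w \<Longrightarrow> depth v = depth w"
  by (cases v; cases w) auto

text \<open>Every label on an outgoing edge carries the colour of its source, and an internal vertex
  has such an edge, so the label set determines the colour.\<close>

lemma stage_class_colouring:
  assumes "(v, w) \<in> stage_rel C X p (class_colouring f h)"
  shows "class_colouring f h v = class_colouring f h w"
proof -
  have fst: "fst ` edge_label (class_colouring f h) ` out_edges C X p u = {class_colouring f h u}"
    if "u \<in> internal C X p" for u
  proof -
    have "fst (edge_label (class_colouring f h) e) = class_colouring f h u"
      if "e \<in> out_edges C X p u" for e
      using that by (cases e) (auto simp: out_edges_def)
    moreover have "out_edges C X p u \<noteq> {}"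
      using that by (simp add: internal_def)
    ultimately show ?thesis
      by (force simp: image_iff)
  qed
  show ?thesis
    using assms fst[of v] fst[of w] by (auto simp: stage_rel_def)
qed

lemma class_colouring_stage:
  assumes "c \<in> C" "xs \<in> prefixes X i" "d \<in> C" "ys \<in> prefixes X i" "i < p"
    and "class_colouring f h (Node c xs) = class_colouring f h (Node d ys)"
  shows "(Node c xs, Node d ys) \<in> stage_rel C X p (class_colouring f h)"
  using assms by (simp add: stage_rel_def Node_internal out_edges_Node image_image)

text \<open>On a level of internal vertices the stages are the colour fibres. Since \<open>h\<close>
  maps \<open>C\<close> onto \<open>C\<close> for every history, each history already shows all
  colours of the level, one per class.\<close>

lemma naive_class_colouring:
  assumes f: "inj_on f C"
    and h: "\<And>i xs. i < p \<Longrightarrow> xs \<in> prefixes X i \<Longrightarrow> (\<lambda>c. h c xs) ` C = C"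
  shows "naive_staged_tree C X p (class_colouring f h)"
  unfolding naive_staged_tree_def
proof (intro conjI ballI)
  let ?\<kappa> = "class_colouring f h"
  show "staged_tree C X p ?\<kappa>"
    by (auto simp: staged_tree_def dest: stage_class_colouring class_colouring_depth)
  fix k assume "k \<in> {1..p}"
  then obtain i where i: "k = Suc i" "i < p"
    by (cases k) auto
  then have lev: "level C X p k = {Node c xs | c xs. c \<in> C \<and> xs \<in> prefixes X i}"
    by (simp add: level_Suc)
  have "stage_rel C X p ?\<kappa> `` {v} = {w \<in> level C X p k. ?\<kappa> w = ?\<kappa> v}"
    if v: "v \<in> level C X p k" for v
  proof (intro equalityI subsetI)
    fix w assume "w \<in> stage_rel C X p ?\<kappa> `` {v}"
    then have r: "(v, w) \<in> stage_rel C X p ?\<kappa>" by simp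
    then have "?\<kappa> w = ?\<kappa> v"
      by (auto dest: stage_class_colouring)
    moreover have "w \<in> level C X p k"
      using r class_colouring_depth[OF stage_class_colouring[OF r]] v
      by (auto simp: level_def stage_rel_def internal_def)
    ultimately show "w \<in> {w \<in> level C X p k. ?\<kappa> w = ?\<kappa> v}" by simp
  next
    fix w assume w: "w \<in> {w \<in> level C X p k. ?\<kappa> w = ?\<kappa> v}"
    obtain c xs d ys where "v = Node c xs" "c \<in> C" "xs \<in> prefixes X i"
      "w = Node d ys" "d \<in> C" "ys \<in> prefixes X i"
      using v w unfolding lev by blast
    then show "w \<in> stage_rel C X p ?\<kappa> `` {v}"
      using w i class_colouring_stage[of c xs i d ys f h] by simp
  qed
  then have "card (level C X p k // stage_rel C X p ?\<kappa>) = card (?\<kappa> ` level C X p k)"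
    by (rule card_quotient_eq_card_image)
  also have "?\<kappa> ` level C X p k = (\<lambda>c. prod_encode (k, f c)) ` C"
  proof -
    have "?\<kappa> ` level C X p k =
        (\<Union>xs\<in>prefixes X i. (\<lambda>c. prod_encode (k, f c)) ` (\<lambda>c. h c xs) ` C)"
      unfolding lev by (auto simp: i length_prefixes) (force simp: length_prefixes i)
    also have "\<dots> = (\<Union>xs\<in>prefixes X i. (\<lambda>c. prod_encode (k, f c)) ` C)"
      using h i by simp
    also have "\<dots> = (\<lambda>c. prod_encode (k, f c)) ` C"
      using prefixes_nonempty[of i] i by auto
    finally show ?thesis .
  qed
  also have "card \<dots> = card C"
    using f by (intro card_image) (auto simp: inj_on_def)
  finally show "card (level C X p k // stage_rel C X p ?\<kappa>) = card C" .
qed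

text \<open>The parameters are \<open>q\<close> at the root and the law \<open>r i d\<close> at the
  stage of depth \<open>Suc i\<close> and class \<open>d\<close>; along a path they multiply to the
  given product.\<close>

lemma naive_staged_spaceI:
  fixes q :: "'c \<Rightarrow> real" and r :: "nat \<Rightarrow> 'c \<Rightarrow> 'x \<Rightarrow> real"
  assumes h: "\<And>i xs. i < p \<Longrightarrow> xs \<in> prefixes X i \<Longrightarrow> (\<lambda>c. h c xs) ` C = C"
    and q: "\<And>c. c \<in> C \<Longrightarrow> q c > 0" "(\<Sum>c\<in>C. q c) = 1"
    and r: "\<And>i c x. i < p \<Longrightarrow> c \<in> C \<Longrightarrow> x \<in> X (Suc i) \<Longrightarrow> r i c x > 0"
      "\<And>i c. i < p \<Longrightarrow> c \<in> C \<Longrightarrow> (\<Sum>x\<in>X (Suc i). r i c x) = 1"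
    and P: "set_pmf P \<subseteq> outcomes C X p"
      "\<And>c xs. c \<in> C \<Longrightarrow> xs \<in> prefixes X p \<Longrightarrow>
        pmf P (c, xs) = q c * (\<Prod>i<p. r i (h c (take i xs)) (xs ! i))"
  shows "P \<in> naive_staged_space C X p"
proof -
  obtain f :: "'c \<Rightarrow> nat" where f: "inj_on f C"
    using finite_imp_inj_to_nat_seg[OF finite_C] by blast
  let ?\<kappa> = "class_colouring f h"
  \<comment> \<open>\<open>Inl\<close> occurs only on edges from the root. Otherwise the colour is
    decoded: its depth is \<open>Suc i\<close> for feature position \<open>i\<close>, hence the
    subtraction of 1, and \<open>inv_into C f\<close> recovers the class.\<close>
  define y where "y l = (case l of (n, Inl c) \<Rightarrow> q c
    | (n, Inr x) \<Rightarrow> r (fst (prod_decode n) - 1) (inv_into C f (snd (prod_decode n))) x)"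
    for l :: "('c, 'x) label"
  have hC: "h c xs \<in> C" if "c \<in> C" "xs \<in> prefixes X i" "i < p" for c xs i
    using h that by blast
  have y_Root: "y (edge_label ?\<kappa> (Root, Node c [])) = q c" for c
    by (simp add: y_def)
  have y_Node: "y (edge_label ?\<kappa> (Node c xs, Node c (xs @ [x]))) = r i (h c xs) x"
    if "c \<in> C" "xs \<in> prefixes X i" "i < p" for c xs x i
    using f that by (simp add: y_def hC length_prefixes)
  have "y \<in> tree_params C X p ?\<kappa>"
    unfolding tree_params_def
  proof (intro CollectI conjI ballI)
    fix e assume "e \<in> edges C X p"
    then show "y (edge_label ?\<kappa> e) \<in> {0<..<1}"
    proof (cases rule: edges_cases)
      case (1 c)
      then show ?thesis
        using q less_one_of_sum_eq_one[OF finite_C card_C, of q]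
        by (simp add: y_Root del: edge_label.simps)
    next
      case (2 c xs x i)
      then show ?thesis
        using r less_one_of_sum_eq_one[OF finite_X_Suc card_X_Suc, of i "r i (h c xs)"]
        by (simp add: y_Node hC del: edge_label.simps)
    qed
  next
    fix v assume "v \<in> internal C X p"
    then show "(\<Sum>e\<in>out_edges C X p v. y (edge_label ?\<kappa> e)) = 1"
    proof (cases rule: internal_cases)
      case 1
      then show ?thesis
        using q by (simp add: out_edges_Root sum.reindex inj_on_def y_Root del: edge_label.simps)
    next
      case (2 c xs i)
      then show ?thesis
        using r by (simp add: out_edges_Node sum.reindex inj_on_def y_Node hC
            del: edge_label.simps)
    qed
  qed
  moreover have "pmf P (c, xs) = (\<Prod>e\<in>root_path (Node c xs). y (edge_label ?\<kappa> e))"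
    if "c \<in> C" "xs \<in> prefixes X p" for c xs
  proof -
    have "y (edge_label ?\<kappa> (Node c (take i xs), Node c (take (Suc i) xs))) =
        r i (h c (take i xs)) (xs ! i)" if "i < p" for i
      using y_Node[of c "take i xs" i "xs ! i"] that \<open>c \<in> C\<close> \<open>xs \<in> prefixes X p\<close>
      by (simp add: take_prefixes take_Suc_conv_app_nth length_prefixes del: edge_label.simps)
    then show ?thesis
      using that by (simp add: root_path_prod y_Root P length_prefixes
          del: edge_label.simps root_path.simps)
  qed
  ultimately have "P \<in> staged_tree_model C X p ?\<kappa>"
    using P(1) by (auto simp: staged_tree_model_def outcomes_def simp del: root_path.simps)
  moreover have "naive_staged_tree C X p ?\<kappa>"
    by (rule naive_class_colouring[OF f h])
  ultimately show ?thesis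
    unfolding naive_staged_space_def by blast
qed

section \<open>Naive Bayes mass functions and the inclusion\<close>

text \<open>Here \<open>q\<close> is the class marginal and \<open>r\<close> the conditional law of
  one feature given the class. Full support of \<open>P\<close> makes both positive and the
  divisions legitimate.\<close>

lemma naive_bn_factorization:
  assumes "P \<in> naive_bn_space C X p"
  obtains q :: "'c \<Rightarrow> real" and r :: "nat \<Rightarrow> 'c \<Rightarrow> 'x \<Rightarrow> real"
  where "\<And>c. c \<in> C \<Longrightarrow> q c > 0" "(\<Sum>c\<in>C. q c) = 1"
    "\<And>i c x. i < p \<Longrightarrow> c \<in> C \<Longrightarrow> x \<in> X (Suc i) \<Longrightarrow> r i c x > 0"
    "\<And>i c. i < p \<Longrightarrow> c \<in> C \<Longrightarrow> (\<Sum>x\<in>X (Suc i). r i c x) = 1"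
    "\<And>c xs. c \<in> C \<Longrightarrow> xs \<in> prefixes X p \<Longrightarrow>
        pmf P (c, xs) = q c * (\<Prod>i<p. r i c (xs ! i))"
proof -
  from assms have set: "set_pmf P = C \<times> prefixes X p" and mk: "markov C X p (naive_graph p) P"
    by (auto simp: naive_bn_space_def bn_model_def prob_simplex_def outcomes_def)
  define q where "q c = measure (measure_pmf P) {w. fst w = c}" for c
  define m where "m i c x = measure (measure_pmf P) {w. fst w = c \<and> snd w ! i = x}" for i c x
  have pos: "0 < measure (measure_pmf P) S" if "w \<in> S" "w \<in> set_pmf P" for w S
    using that by (meson disjoint_iff measure_measure_pmf_not_zero zero_less_measure_iff)
  have q_pos: "q c > 0" if "c \<in> C" for c
  proof -
    obtain zs where "zs \<in> prefixes X p"
      using prefixes_nonempty by blast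
    then show ?thesis
      unfolding q_def using that set by (intro pos[of "(c, zs)"]) auto
  qed
  have m_pos: "m i c x > 0" if "c \<in> C" "i < p" "x \<in> X (Suc i)" for i c x
  proof -
    obtain zs where "zs \<in> prefixes X p"
      using prefixes_nonempty by blast
    \<comment> \<open>Overwriting position \<open>i\<close> of any tuple yields a support point
      inside the event.\<close>
    then have "zs[i := x] \<in> prefixes X p" "zs[i := x] ! i = x"
      using that by (auto simp: update_prefixes length_prefixes)
    then show ?thesis
      unfolding m_def using that set by (intro pos[of "(c, zs[i := x])"]) auto
  qed
  have "(\<Sum>c\<in>C. q c) = measure (measure_pmf P) (\<Union>c\<in>C. {w. fst w = c})"
    unfolding q_def
    by (intro measure_pmf.finite_measure_finite_Union[symmetric])
      (auto simp: finite_C disjoint_family_on_def)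
  also have "\<dots> = 1"
    using set by (subst measure_pmf.prob_eq_1) (auto simp: AE_measure_pmf_iff)
  finally have q_sum: "(\<Sum>c\<in>C. q c) = 1" .
  have m_sum: "(\<Sum>x\<in>X (Suc i). m i c x) = q c" if "i < p" for i c
  proof -
    have "(\<Sum>x\<in>X (Suc i). m i c x) =
        measure (measure_pmf P) (\<Union>x\<in>X (Suc i). {w. fst w = c \<and> snd w ! i = x})"
      unfolding m_def using that
      by (intro measure_pmf.finite_measure_finite_Union[symmetric])
        (auto simp: finite_X_Suc disjoint_family_on_def)
    \<comment> \<open>The union differs from the class event only by outcomes with a feature value
      outside \<open>X (Suc i)\<close>, a null set.\<close>
    also have "\<dots> = q c"
      unfolding q_def using set that
      by (intro measure_pmf.finite_measure_eq_AE) (auto simp: AE_measure_pmf_iff nth_prefixes)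
    finally show ?thesis .
  qed
  have fac: "pmf P (c, xs) = q c * (\<Prod>i<p. m i c (xs ! i) / q c)"
    if "c \<in> C" "xs \<in> prefixes X p" for c xs
  proof -
    let ?t = "\<lambda>v. \<P>(w' in measure_pmf P. rv_val v w' = rv_val v (c, xs)
        \<bar> \<forall>u\<in>parents (naive_graph p) v. rv_val u w' = rv_val u (c, xs))"
    \<comment> \<open>\<open>Class\<close> has no parents, so its conditioning event is the whole
      space and the factor is the marginal.\<close>
    have "?t Class = q c"
      by (simp add: cond_prob_def parents_def naive_graph_def q_def rv_val_eq del: rv_val.simps)
    moreover have "?t (Feature (Suc i)) = m i c (xs ! i) / q c" if "i < p" for i
    proof -
      have "parents (naive_graph p) (Feature (Suc i)) = {Class}"
        using that by (auto simp: parents_def naive_graph_def)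
      then show ?thesis
        by (simp add: cond_prob_def q_def m_def rv_val_eq conj_commute del: rv_val.simps)
    qed
    moreover have "(\<Prod>v\<in>rvs p. ?t v) = ?t Class * (\<Prod>i<p. ?t (Feature (Suc i)))"
    proof -
      \<comment> \<open>Features are numbered from 1, list positions from 0.\<close>
      have "rvs p = insert Class ((\<lambda>i. Feature (Suc i)) ` {..<p})"
        unfolding rvs_def image_Suc_lessThan[symmetric] image_image ..
      moreover have "Class \<notin> (\<lambda>i. Feature (Suc i)) ` {..<p}" by auto
      ultimately show ?thesis
        by (simp add: prod.reindex inj_on_def)
    qed
    ultimately show ?thesis
      using mk that by (simp add: markov_def outcomes_def)
  qed
  show thesis
  proof (rule that[of q "\<lambda>i c x. m i c x / q c"])
    show "(\<Sum>x\<in>X (Suc i). m i c x / q c) = 1" if "i < p" "c \<in> C" for i c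
      using m_sum[of i c] q_pos[of c] that by (simp add: sum_divide_distrib[symmetric])
  qed (use q_pos q_sum m_pos fac in auto)
qed

lemma naive_bn_subset_naive_staged: "naive_bn_space C X p \<subseteq> naive_staged_space C X p"
proof
  fix P assume P: "P \<in> naive_bn_space C X p"
  then have sub: "set_pmf P \<subseteq> outcomes C X p"
    by (simp add: naive_bn_space_def bn_model_def prob_simplex_def)
  show "P \<in> naive_staged_space C X p"
  proof (rule naive_bn_factorization[OF P], goal_cases)
    case (1 q r)
    then show ?case
      using sub by (intro naive_staged_spaceI[where h = "\<lambda>c xs. c" and q = q and r = r]) simp_all
  qed
qed

section \<open>Strictness for two or more features\<close>

text \<open>For a fixed class and frozen remaining features, the mass is a function of the first
  feature times a function of the second, so the 2 by 2 minors of this table vanish.\<close>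

lemma naive_bn_cross_ratio:
  assumes "P \<in> naive_bn_space C X p" "p \<ge> 2" "c \<in> C" "zs \<in> prefixes X p"
    and "a \<in> X 1" "b \<in> X 1" "u \<in> X 2" "v \<in> X 2"
  defines "w \<equiv> \<lambda>x y. (c, zs[0 := x, 1 := y])"
  shows "pmf P (w a u) * pmf P (w b v) = pmf P (w a v) * pmf P (w b u)"
proof -
  obtain q r where fac: "\<And>c xs. c \<in> C \<Longrightarrow> xs \<in> prefixes X p \<Longrightarrow>
      pmf P (c, xs) = q c * (\<Prod>i<p. r i c (xs ! i))"
    using naive_bn_factorization[OF assms(1)] by metis
  obtain n where n: "p = Suc (Suc n)"
    using \<open>p \<ge> 2\<close> by (metis add_2_eq_Suc le_Suc_ex)
  have "pmf P (w x y) = q c * (r 0 c x * (r 1 c y * (\<Prod>i<n. r (Suc (Suc i)) c (zs ! Suc (Suc i)))))"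
    if "x \<in> X 1" "y \<in> X 2" for x y
  proof -
    have "zs[0 := x, 1 := y] \<in> prefixes X p"
      using that assms(4) by (intro update_prefixes) (auto simp: numeral_2_eq_2)
    then show ?thesis
      using fac[of c] assms(3,4) by (simp add: w_def n prod.lessThan_Suc_shift length_prefixes
          del: prod.lessThan_Suc)
  qed
  then show ?thesis
    using assms by simp
qed

lemma naive_staged_not_subset_naive_bn:
  assumes "p \<ge> 2"
  obtains P where "P \<in> naive_staged_space C X p" "P \<notin> naive_bn_space C X p"
proof -
  obtain c0 c1 where c: "c0 \<in> C" "c1 \<in> C" "c0 \<noteq> c1"
    using card_C by (auto simp: card_le_Suc_iff numeral_2_eq_2)
  obtain a b where ab: "a \<in> X 1" "b \<in> X 1" "a \<noteq> b"
    using card_X[of 1] assms by (auto simp: card_le_Suc_iff numeral_2_eq_2)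
  obtain u v where uv: "u \<in> X 2" "v \<in> X 2" "u \<noteq> v"
    using card_X[of 2] assms by (auto simp: card_le_Suc_iff numeral_2_eq_2)
  \<comment> \<open>Only the history \<open>[a]\<close> is affected, so the swap acts on the law of
    the second feature alone.\<close>
  define h where "h c xs = (if xs = [a] then Transposition.transpose c0 c1 c else c)" for c xs
  \<comment> \<open>Position 1 is the second feature. In class \<open>c1\<close> its value
    \<open>u\<close> gets double weight, whence the denominator \<open>card (X 2) + 1\<close>; all
    other laws are uniform.\<close>
  define r :: "nat \<Rightarrow> 'c \<Rightarrow> 'x \<Rightarrow> real" where
    "r i d x = (if i = 1 \<and> d = c1 then (if x = u then 2 else 1) / (card (X 2) + 1)
       else 1 / card (X (Suc i)))" for i d x
  have h: "(\<lambda>c. h c xs) ` C = C" for xs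
    using c by (cases "xs = [a]") (simp_all add: h_def)
  have r_pos: "r i d x > 0" if "i < p" for i d x
    using card_X_Suc[OF that] by (auto simp: r_def)
  have r_sum: "(\<Sum>x\<in>X (Suc i). r i d x) = 1" if "i < p" for i d
  proof (cases "i = 1 \<and> d = c1")
    case True
    have "finite (X 2)"
      using finite_X[of 2] assms by simp
    then have "(\<Sum>x\<in>X 2. if x = u then 2 else 1 :: real) = 2 + card (X 2 - {u})"
      using uv by (simp add: sum.remove)
    then show ?thesis
      using True uv \<open>finite (X 2)\<close> card_gt_0_iff[of "X 2"]
      by (auto simp: r_def sum_divide_distrib[symmetric] numeral_2_eq_2[symmetric] of_nat_diff)
  next
    case False
    then show ?thesis
      using card_X_Suc[OF that] by (auto simp: r_def)
  qed
  let ?f = "\<lambda>(c, xs). 1 / card C * (\<Prod>i<p. r i (h c (take i xs)) (xs ! i))"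
  have "finite (outcomes C X p)"
    by (simp add: outcomes_def finite_C finite_prefixes)
  moreover have "0 \<le> ?f w" for w
    using r_pos[THEN less_imp_le] by (auto simp: case_prod_unfold intro!: prod_nonneg divide_nonneg_nonneg)
  moreover have "sum ?f (outcomes C X p) = 1"
  proof -
    have "sum ?f (outcomes C X p) = (\<Sum>c\<in>C. 1 / card C *
        (\<Sum>xs\<in>prefixes X p. \<Prod>i<p. r i (h c (take i xs)) (xs ! i)))"
      by (simp add: outcomes_def sum.cartesian_product[symmetric] sum_distrib_left)
    \<comment> \<open>For every history, \<open>r i (h c xs)\<close> is a probability law on
      \<open>X (Suc i)\<close>.\<close>
    also have "\<dots> = 1"
      using card_C by (subst sum_prefixes_prod) (auto simp: r_sum)
    finally show ?thesis .
  qed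
  ultimately obtain P where P: "set_pmf P \<subseteq> outcomes C X p"
    "\<And>w. w \<in> outcomes C X p \<Longrightarrow> pmf P w = ?f w"
    by (rule obtain_pmf) blast+
  have staged: "P \<in> naive_staged_space C X p"
    by (rule naive_staged_spaceI[where h = h and q = "\<lambda>c. 1 / card C" and r = r])
      (use h r_pos r_sum P card_C finite_C in \<open>auto simp: outcomes_def card_gt_0_iff\<close>)
  have "P \<notin> naive_bn_space C X p"
  proof
    assume bn: "P \<in> naive_bn_space C X p"
    obtain zs where zs: "zs \<in> prefixes X p"
      using prefixes_nonempty by blast
    obtain n where n: "p = Suc (Suc n)"
      using assms by (metis add_2_eq_Suc le_Suc_ex)
    \<comment> \<open>\<open>K\<close> collects the factors of the class, the first feature and the
      features after the second. These laws are uniform, so \<open>K\<close> does not depend on the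
      values chosen.\<close>
    define K where "K = 1 / card C * (1 / card (X 1)) *
      (\<Prod>i<n. 1 / card (X (Suc (Suc (Suc i)))) :: real)"
    have "K \<noteq> 0"
    proof -
      have "card (X (Suc i)) \<noteq> 0" if "i < p" for i
        using card_X_Suc[OF that] by simp
      then show ?thesis
        using card_C n by (simp add: K_def)
    qed
    have val: "pmf P (c0, zs[0 := x, 1 := y]) = K * r 1 (h c0 [x]) y"
      if "x \<in> X 1" "y \<in> X 2" for x y
    proof -
      \<comment> \<open>With the first two entries exposed, the history before the second feature
        reduces to \<open>[x]\<close>.\<close>
      obtain s t ts where "zs = s # t # ts"
        using length_prefixes[OF zs] n by (metis length_Suc_conv)
      moreover have "zs[0 := x, 1 := y] \<in> prefixes X p"
        using that zs by (intro update_prefixes) (auto simp: numeral_2_eq_2)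
      ultimately show ?thesis
        using P(2)[of "(c0, zs[0 := x, 1 := y])"] c(1)
        by (simp add: outcomes_def n prod.lessThan_Suc_shift K_def r_def
          del: prod.lessThan_Suc)
    qed
    \<comment> \<open>The relabelling sends \<open>c0\<close> to \<open>c1\<close> after
      \<open>a\<close> and fixes it after \<open>b\<close>, so the vanishing minor compares the
      second-feature laws of the two classes.\<close>
    have "r 1 c1 u * r 1 c0 v = r 1 c1 v * r 1 c0 u"
      using naive_bn_cross_ratio[OF bn assms c(1) zs ab(1,2) uv(1,2)] \<open>K \<noteq> 0\<close> ab(3)
      unfolding val[OF ab(1) uv(1)] val[OF ab(1) uv(2)] val[OF ab(2) uv(1)] val[OF ab(2) uv(2)]
      by (simp add: h_def)
    \<comment> \<open>One side of the identity is therefore twice the other, and both are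
      positive.\<close>
    moreover have "r 1 c1 u = 2 * r 1 c1 v" "r 1 c0 u = r 1 c0 v"
      using c(3) uv(3) by (simp_all add: r_def)
    moreover have "r 1 c1 v > 0" "r 1 c0 v > 0"
      using r_pos assms by simp_all
    ultimately show False
      by simp
  qed
  with staged show thesis by (rule that)
qed

end

text \<open>With at most one feature both spaces consist of all strictly positive mass functions on
  the outcomes, so strictness starts at two features.\<close>

theorem proposition5:
  fixes C :: "'c set" and X :: "nat \<Rightarrow> 'x set" and p :: nat
  assumes "finite C" and "card C \<ge> 2"
    and "\<And>k. k \<in> {1..p} \<Longrightarrow> finite (X k)"
    and "\<And>k. k \<in> {1..p} \<Longrightarrow> card (X k) \<ge> 2"
  shows "naive_bn_space C X p \<subseteq> naive_staged_space C X p \<and>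
    (p \<ge> 2 \<longrightarrow> naive_bn_space C X p \<subset> naive_staged_space C X p)"
proof -
  interpret classifier C X p
    using assms by unfold_locales
  show ?thesis
    using naive_bn_subset_naive_staged naive_staged_not_subset_naive_bn by blast
qed

end
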